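(* Let $G$ be a residually finite, finitely generated solvable group of infinite Prüfer rank with a nontrivial infinite order element $x\in\mathrm{Fitt}(G)$ such that $x$ is at least strictly exponentially distorted. Then $n\preceq\mathrm{RF}_G(n)$. If $x$ has nilpotent depth $m>1$, then $n^{m+1}\preceq\mathrm{RF}_G(n)$.
   Context: A finitely generated group $G$ has Prüfer rank $r$ if every finitely generated subgroup of $G$ can be generated by at most $r$ elements and $r$ is the least such natural number; if no such $r$ exists, $G$ has infinite Prüfer rank. $\mathbb{N}$ denotes the positive integers. For nondecreasing functions $f,g$ on $\mathbb{N}$, $f\preceq g$ means that there is a constant $C>0$ (which may be taken to be an integer) with $f(n)\le C\,g(Cn)$ for all $n$. For a finitely generated group $G$ with finite generating subset $S$, $\|x\|_S$ is the word length of $x$. For a nondecreasing $f:\mathbb{N}\to\mathbb{N}$, an infinite order element $x\in G$ is strictly $f$-distorted if there are constants $C_1,C_2>0$ with $C_1|n|\le f(\|x^n\|_S)\le C_2|n|$ for all integers $n>0$. The element $x$ is at least strictly exponentially distorted if it is strictly $f$-distorted for some nondecreasing $f:\mathbb{N}\to\mathbb{N}$ with $2^n\preceq f(n)\preceq 2^{2^n}$. $\gamma_m(N)$ is the $m$-th term of the lower central series, with $\gamma_1(N)=N$. $\mathrm{Fitt}(G)$, the Fitting subgroup, is the subgroup generated by all normal nilpotent subgroups of $G$. A nontrivial element $x\in\mathrm{Fitt}(G)$ has nilpotent depth $m$ if there is a normal nilpotent subgroup $N$ of $G$ such that $m$ is the largest natural number with $\langle x\rangle\cap\gamma_m(N)\ne\{1\}$.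 For a finitely generated, residually finite group $G$ and $x\in G\setminus\{1\}$ let $\mathrm{D}_G(x)=\min\{|H| : \varphi:G\to H \text{ a surjective homomorphism},\ |H|<\infty,\ \varphi(x)\ne 1\}$, and $\mathrm{RF}_{G}(n)=\mathrm{RF}_{G,S}(n)=\max\{\mathrm{D}_G(x) : \|x\|_S\le n,\ x\ne 1\}$; the choice of $S$ does not affect $\mathrm{RF}_G$ up to $\preceq$ in both directions. *)

theory Defs
  imports Complex_Main "HOL-Algebra.Algebra"
begin

text \<open>Functions on the positive integers are represented by total functions on \<^typ>\<open>nat\<close> whose
  value at 0 is never consulted.\<close>

definition growth_le :: "(nat \<Rightarrow> nat) \<Rightarrow> (nat \<Rightarrow> nat) \<Rightarrow> bool" (infix "\<preceq>" 50) where
  "f \<preceq> g \<longleftrightarrow> (\<exists>C::nat. C > 0 \<and> (\<forall>n\<ge>1. f n \<le> C * g (C * n)))"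

definition finite_generating_set :: "('a, 'b) monoid_scheme \<Rightarrow> 'a set \<Rightarrow> bool" where
  "finite_generating_set G S \<longleftrightarrow> finite S \<and> S \<subseteq> carrier G \<and> generate G S = carrier G"

definition word_length :: "('a, 'b) monoid_scheme \<Rightarrow> 'a set \<Rightarrow> 'a \<Rightarrow> nat" where
  "word_length G S x =
     (LEAST n. \<exists>ws. length ws = n \<and> set ws \<subseteq> S \<union> m_inv G ` S \<and>
        foldr (\<otimes>\<^bsub>G\<^esub>) ws \<one>\<^bsub>G\<^esub> = x)"

definition strictly_distorted ::
    "('a, 'b) monoid_scheme \<Rightarrow> 'a set \<Rightarrow> (nat \<Rightarrow> nat) \<Rightarrow> 'a \<Rightarrow> bool" where
  "strictly_distorted G S f x \<longleftrightarrow>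
     (\<exists>C1 C2 :: real. C1 > 0 \<and> C2 > 0 \<and>
        (\<forall>n::nat. n > 0 \<longrightarrow>
           C1 * real n \<le> real (f (word_length G S (x [^]\<^bsub>G\<^esub> n))) \<and>
           real (f (word_length G S (x [^]\<^bsub>G\<^esub> n))) \<le> C2 * real n))"

definition at_least_strictly_exp_distorted ::
    "('a, 'b) monoid_scheme \<Rightarrow> 'a set \<Rightarrow> 'a \<Rightarrow> bool" where
  "at_least_strictly_exp_distorted G S x \<longleftrightarrow>
     (\<exists>f. f ` {1..} \<subseteq> {1..} \<and> mono_on {1..} f \<and>
        (\<lambda>n. 2 ^ n) \<preceq> f \<and> f \<preceq> (\<lambda>n. 2 ^ (2 ^ n)) \<and>
        strictly_distorted G S f x)"

definition fg_subgroups_generated_by :: "('a, 'b) monoid_scheme \<Rightarrow> nat \<Rightarrow> bool" where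
  "fg_subgroups_generated_by G r \<longleftrightarrow>
     (\<forall>A. finite A \<and> A \<subseteq> carrier G \<longrightarrow>
        (\<exists>B. finite B \<and> B \<subseteq> carrier G \<and> card B \<le> r \<and> generate G B = generate G A))"

definition has_prufer_rank :: "('a, 'b) monoid_scheme \<Rightarrow> nat \<Rightarrow> bool" where
  "has_prufer_rank G r \<longleftrightarrow>
     fg_subgroups_generated_by G r \<and> (\<forall>s. fg_subgroups_generated_by G s \<longrightarrow> r \<le> s)"

definition infinite_prufer_rank :: "('a, 'b) monoid_scheme \<Rightarrow> bool" where
  "infinite_prufer_rank G \<longleftrightarrow> (\<nexists>r. has_prufer_rank G r)"

definition commutator_subgroup ::
    "('a, 'b) monoid_scheme \<Rightarrow> 'a set \<Rightarrow> 'a set \<Rightarrow> 'a set" where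
  "commutator_subgroup G H K =
     generate G {h \<otimes>\<^bsub>G\<^esub> k \<otimes>\<^bsub>G\<^esub> inv\<^bsub>G\<^esub> h \<otimes>\<^bsub>G\<^esub> inv\<^bsub>G\<^esub> k | h k. h \<in> H \<and> k \<in> K}"

text \<open>The series starts at index 1, i.e. the first term is the subgroup \<open>N\<close> itself; index 0 is
  not meaningful.\<close>

definition lower_central :: "('a, 'b) monoid_scheme \<Rightarrow> 'a set \<Rightarrow> nat \<Rightarrow> 'a set" where
  "lower_central G N m = ((\<lambda>H. commutator_subgroup G H N) ^^ (m - 1)) N"

definition normal_nilpotent :: "('a, 'b) monoid_scheme \<Rightarrow> 'a set \<Rightarrow> bool" where
  "normal_nilpotent G N \<longleftrightarrow> N \<lhd> G \<and> (\<exists>c\<ge>1. lower_central G N c = {\<one>\<^bsub>G\<^esub>})"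

definition fitting :: "('a, 'b) monoid_scheme \<Rightarrow> 'a set" where
  "fitting G = generate G (\<Union>{N. normal_nilpotent G N})"

definition has_nilpotent_depth :: "('a, 'b) monoid_scheme \<Rightarrow> 'a \<Rightarrow> nat \<Rightarrow> bool" where
  "has_nilpotent_depth G x m \<longleftrightarrow>
     (\<exists>N. normal_nilpotent G N \<and>
        m \<ge> 1 \<and> generate G {x} \<inter> lower_central G N m \<noteq> {\<one>\<^bsub>G\<^esub>} \<and>
        (\<forall>k\<ge>1. generate G {x} \<inter> lower_central G N k \<noteq> {\<one>\<^bsub>G\<^esub>} \<longrightarrow> k \<le> m))"

text \<open>Finite target groups are taken with carrier in \<^typ>\<open>nat\<close>; this loses no generality, as
  every finite group is isomorphic to such a group.\<close>

definition residually_finite :: "('a, 'b) monoid_scheme \<Rightarrow> bool" where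
  "residually_finite G \<longleftrightarrow>
     (\<forall>x \<in> carrier G - {\<one>\<^bsub>G\<^esub>}. \<exists>(H :: nat monoid) \<phi>.
        group H \<and> finite (carrier H) \<and> \<phi> \<in> hom G H \<and> \<phi> x \<noteq> \<one>\<^bsub>H\<^esub>)"

definition separation_depth :: "('a, 'b) monoid_scheme \<Rightarrow> 'a \<Rightarrow> nat" where
  "separation_depth G x =
     (LEAST k. \<exists>(H :: nat monoid) \<phi>.
        group H \<and> finite (carrier H) \<and> \<phi> \<in> epi G H \<and> \<phi> x \<noteq> \<one>\<^bsub>H\<^esub> \<and> k = order H)"

definition RF :: "('a, 'b) monoid_scheme \<Rightarrow> 'a set \<Rightarrow> nat \<Rightarrow> nat" where
  "RF G S n =
     Max {separation_depth G x | x. x \<in> carrier G \<and> x \<noteq> \<one>\<^bsub>G\<^esub> \<and> word_length G S x \<le> n}"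

end

theory Submission
  imports Defs "HOL-Computational_Algebra.Primes"
begin

text \<open>Let \<open>L = lcm(1, \<dots>, k) \<le> 16\<^sup>k\<close>. By exponential distortion, \<open>x ^ (j L\<^sup>c)\<close> has length \<open>O(k)\<close> for fixed
  \<open>j\<close> and \<open>c\<close>. If it survives in a finite quotient, the image of \<open>x\<close> has order greater than \<open>k\<close>, which
  gives the linear bound. For the polynomial bound let \<open>x ^ j\<close> lie in the \<open>m\<close>-th term of the lower
  central series of \<open>N\<close>, let \<open>\<gamma>\<^sub>c(N) = 1\<close>, and let \<open>K\<close> be the image of \<open>N\<close>. The exponent of
  \<open>\<gamma>\<^sub>i\<^sub>+\<^sub>1(K)/\<gamma>\<^sub>i\<^sub>+\<^sub>2(K)\<close> divides that of \<open>\<gamma>\<^sub>i(K)/\<gamma>\<^sub>i\<^sub>+\<^sub>1(K)\<close>. If \<open>L\<close> annihilated the \<open>m\<close>-th factor it would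
  annihilate all later ones, and \<open>L\<^sup>c\<close> would kill the image of \<open>x ^ j\<close>. Taking the power \<open>L\<^sup>c\<close> instead
  of \<open>L\<close> thus makes it harmless that \<open>x ^ j\<close> may fall into a deeper term in the quotient. So \<open>L\<close>
  annihilates none of the first \<open>m\<close> factors, each of which has more than \<open>k\<close> elements, and the first
  one has more than \<open>k\<^sup>2\<close>, since a commutator pairing on it does not vanish on \<open>L\<close>-th powers.\<close>

subsection \<open>Least common multiples\<close>

text \<open>With \<open>q = p ^ a\<close>, Vandermonde expands \<open>2 * n choose n\<close> over
  the splitting of \<open>2 * n\<close> into \<open>q\<close> and \<open>2 * n - q\<close>. The term
  \<open>i = 0\<close> vanishes because \<open>2 * n - q < n\<close>. For \<open>0 < i < q\<close>,
  \<open>q\<close> divides \<open>i * (q choose i)\<close> but not \<open>i\<close>, so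
  \<open>p\<close> divides \<open>q choose i\<close>.\<close>

lemma prime_dvd_central_binomial:
  fixes p n a :: nat
  assumes "Factorial_Ring.prime p" "n < p ^ a" "p ^ a \<le> 2 * n"
  shows "p dvd (2 * n choose n)"
proof -
  define q where "q = p ^ a"
  have "p dvd (q choose i) * ((2 * n - q) choose (n - i))" if "i \<le> n" for i
  proof (cases "i = 0")
    case True
    with assms show ?thesis by (simp add: q_def binomial_eq_0)
  next
    case False
    have "\<not> coprime q (q choose i)"
    proof
      assume "coprime q (q choose i)"
      moreover have "q dvd i * (q choose i)"
        using False times_binomial_minus1_eq[of i q] by simp
      ultimately have "q dvd i"
        using coprime_dvd_mult_left_iff by blast
      with False that assms show False
        using dvd_imp_le[of q i] by (simp add: q_def)
    qed
    with assms(1) show ?thesis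
      by (metis coprime_commute coprime_power_right_iff dvd_mult2 prime_imp_coprime q_def)
  qed
  then have "p dvd (\<Sum>i\<le>n. (q choose i) * ((2 * n - q) choose (n - i)))"
    by (intro dvd_sum) auto
  then show ?thesis
    using assms vandermonde[of q "2 * n - q" n] by (simp add: q_def)
qed

text \<open>Checked one prime at a time. A power \<open>p ^ a \<le> n\<close> already divides
  \<open>Lcm {1..n}\<close>. If \<open>n < p ^ a \<le> 2 * n\<close>, then
  \<open>p ^ (a - 1) \<le> n\<close> because \<open>p \<ge> 2\<close>, and the one missing factor
  \<open>p\<close> comes from the central binomial coefficient.\<close>

lemma Lcm_double_dvd:
  "Lcm {1..2 * n} dvd Lcm {1..n} * (2 * n choose n)" for n :: nat
proof (rule Lcm_least)
  fix r assume r: "r \<in> {1..2 * n}"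
  show "r dvd Lcm {1..n} * (2 * n choose n)"
  proof (rule multiplicity_le_imp_dvd)
    show "r \<noteq> 0" using r by simp
    fix p :: nat assume p: "Factorial_Ring.prime p"
    define a where "a = multiplicity p r"
    have le: "p ^ a \<le> 2 * n"
      using multiplicity_dvd[of p r] dvd_imp_le[of "p ^ a" r] r by (simp add: a_def)
    have "p ^ a dvd Lcm {1..n} * (2 * n choose n)"
    proof (cases "p ^ a \<le> n")
      case True
      with p show ?thesis by (intro dvd_mult2 dvd_Lcm) (auto simp: prime_gt_0_nat Suc_leI)
    next
      case False
      have "a \<noteq> 0" using False r by (cases a) auto
      then obtain b where b: "a = Suc b" by (cases a) auto
      have "2 * p ^ b \<le> p ^ a" using prime_ge_2_nat[OF p] b by simp
      then have "p ^ b dvd Lcm {1..n}"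
        using le p by (intro dvd_Lcm) (auto simp: prime_gt_0_nat Suc_leI)
      moreover have "p dvd (2 * n choose n)"
        using prime_dvd_central_binomial[OF p _ le] False by simp
      ultimately show ?thesis unfolding b power_Suc by (metis mult.commute mult_dvd_mono)
    qed
    moreover have "Lcm {1..n} * (2 * n choose n) \<noteq> 0"
      by (auto simp: Lcm_0_iff_nat)
    ultimately show "multiplicity p r \<le> multiplicity p (Lcm {1..n} * (2 * n choose n))"
      using p unfolding a_def by (intro multiplicity_geI) auto
  qed
qed

lemma Lcm_upto_pow2_le: "Lcm {1..2 ^ k} \<le> (4 :: nat) ^ (2 ^ k)"
proof (induction k)
  case (Suc k)
  let ?n = "2 ^ k :: nat"
  have "Lcm {1..2 * ?n} \<le> Lcm {1..?n} * (2 * ?n choose ?n)"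
    by (rule dvd_imp_le[OF Lcm_double_dvd]) (auto simp: Lcm_0_iff_nat intro!: Nat.gr0I)
  also have "\<dots> \<le> 4 ^ ?n * 2 ^ (2 * ?n)"
    using Suc by (intro mult_mono binomial_le_pow2) auto
  also have "\<dots> = 4 ^ (2 * ?n)"
    by (simp add: power_mult power_mult_distrib flip: power_add mult_2)
  finally show ?case by simp
qed simp

text \<open>The base 16 is the square of 4: rounding \<open>n\<close> up to a power of two at most
  doubles it. Any fixed base would serve later.\<close>

lemma Lcm_upto_le:
  fixes n :: nat
  assumes "n \<ge> 1"
  shows "Lcm {1..n} \<le> 16 ^ n"
proof -
  obtain k where k: "2 ^ k \<le> n" "n < 2 ^ (k + 1)"
    using ex_power_ivl1[of 2 n] assms by auto
  have "Lcm {1..n} \<le> Lcm {1..2 ^ (k + 1)}"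
    using k by (intro dvd_imp_le Lcm_subset) (auto simp: Lcm_0_iff_nat intro!: Nat.gr0I)
  also have "\<dots> \<le> 4 ^ (2 ^ (k + 1))" by (rule Lcm_upto_pow2_le)
  also have "\<dots> \<le> 4 ^ (2 * n)" using k by (intro power_increasing) auto
  also have "\<dots> = 16 ^ n" by (simp add: power_mult)
  finally show ?thesis .
qed

lemma Lcm_upto_pos: "Lcm {1..n} > (0 :: nat)"
  by (auto simp: Lcm_0_iff_nat intro!: Nat.gr0I)

subsection \<open>Commutators modulo a normal subgroup\<close>

abbreviation comm :: "('a, 'b) monoid_scheme \<Rightarrow> 'a \<Rightarrow> 'a \<Rightarrow> 'a" where
  "comm G h k \<equiv> h \<otimes>\<^bsub>G\<^esub> k \<otimes>\<^bsub>G\<^esub> inv\<^bsub>G\<^esub> h \<otimes>\<^bsub>G\<^esub> inv\<^bsub>G\<^esub> k"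

lemma (in group) mult_inv_cancel:
  assumes "x \<in> carrier G" "y \<in> carrier G"
  shows "inv x \<otimes> (x \<otimes> y) = y" "x \<otimes> (inv x \<otimes> y) = y"
  using assms by (metis inv_closed l_inv l_one m_assoc, metis inv_closed r_inv l_one m_assoc)

lemma (in group) conj_pow:
  assumes "h \<in> carrier G" "k \<in> carrier G"
  shows "h \<otimes> k [^] (t::nat) \<otimes> inv h = (h \<otimes> k \<otimes> inv h) [^] t"
proof (induction t)
  case (Suc t)
  have "h \<otimes> k [^] Suc t \<otimes> inv h = (h \<otimes> k [^] t \<otimes> inv h) \<otimes> (h \<otimes> k \<otimes> inv h)"
    using assms by (simp add: m_assoc mult_inv_cancel)
  then show ?case using Suc by simp
qed (use assms in simp)

text \<open>Conjugating \<open>k\<close> by \<open>h\<close> multiplies it by the commutator on the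
  left. As the commutator commutes with \<open>h\<close>, repeating this \<open>t\<close> times
  collects its \<open>t\<close>-th power.\<close>

lemma (in group) comm_pow_left:
  assumes h: "h \<in> carrier G" and k: "k \<in> carrier G"
    and c: "comm G h k \<otimes> h = h \<otimes> comm G h k"
  shows "comm G (h [^] (t::nat)) k = comm G h k [^] t"
proof -
  let ?c = "comm G h k"
  have cc: "?c \<in> carrier G" using h k by simp
  have "h [^] t \<otimes> k \<otimes> inv (h [^] t) = ?c [^] t \<otimes> k"
  proof (induction t)
    case (Suc t)
    have "h [^] Suc t \<otimes> k \<otimes> inv (h [^] Suc t) = h \<otimes> (h [^] t \<otimes> k \<otimes> inv (h [^] t)) \<otimes> inv h"
      unfolding nat_pow_Suc2[OF h] using h k by (simp add: m_assoc inv_mult_group)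
    also have "\<dots> = (h \<otimes> ?c [^] t) \<otimes> k \<otimes> inv h"
      using h k cc Suc by (simp add: m_assoc)
    also have "h \<otimes> ?c [^] t = ?c [^] t \<otimes> h"
      using group_commutes_pow[OF c cc h] by simp
    also have "?c [^] t \<otimes> h \<otimes> k \<otimes> inv h = ?c [^] Suc t \<otimes> k"
      using h k by (simp add: m_assoc)
    finally show ?case .
  qed (use h k in simp)
  then show ?thesis using h k by (simp add: inv_solve_right')
qed

lemma (in group) comm_pow_right:
  assumes h: "h \<in> carrier G" and k: "k \<in> carrier G"
    and c: "comm G h k \<otimes> k = k \<otimes> comm G h k"
  shows "comm G h (k [^] (t::nat)) = comm G h k [^] t"
proof -
  have "h \<otimes> k \<otimes> inv h = comm G h k \<otimes> k" using h k by (simp add: m_assoc)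
  then have "h \<otimes> k [^] t \<otimes> inv h = comm G h k [^] t \<otimes> k [^] t"
    using conj_pow[OF h k, of t] pow_mult_distrib[OF c] h k by simp
  then show ?thesis using h k by (simp add: inv_solve_right')
qed

lemma (in group) commutes_iff_comm:
  assumes "h \<in> carrier G" "k \<in> carrier G"
  shows "comm G h k = \<one> \<longleftrightarrow> h \<otimes> k = k \<otimes> h"
proof -
  have "comm G h k = (h \<otimes> k) \<otimes> inv (k \<otimes> h)" using assms by (simp add: inv_mult_group m_assoc)
  then show ?thesis using assms by (simp add: inv_solve_right')
qed

lemma (in group_hom) hom_commutes_iff:
  "x \<in> carrier G \<Longrightarrow> y \<in> carrier G \<Longrightarrow>
    h (comm G x y) = \<one>\<^bsub>H\<^esub> \<longleftrightarrow> h x \<otimes>\<^bsub>H\<^esub> h y = h y \<otimes>\<^bsub>H\<^esub> h x"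
  using H.commutes_iff_comm[of "h x" "h y"] by simp

text \<open>The commutation required by \<open>comm_pow_left\<close> is assumed only after applying
  \<open>h\<close>, which is what is available when \<open>h\<close> is the projection modulo a term
  of the lower central series.\<close>

lemma (in group_hom) hom_comm_pow_left:
  assumes x: "x \<in> carrier G" and y: "y \<in> carrier G" and c: "h (comm G (comm G x y) x) = \<one>\<^bsub>H\<^esub>"
  shows "h (comm G (x [^] (t::nat)) y) = h (comm G x y [^] t)"
proof -
  have "h (comm G x y) \<otimes>\<^bsub>H\<^esub> h x = h x \<otimes>\<^bsub>H\<^esub> h (comm G x y)"
    using c x y hom_commutes_iff[of "comm G x y" x] by simp
  then show ?thesis
    using x y H.comm_pow_left[of "h x" "h y" t] by (simp add: hom_nat_pow)
qed

lemma (in group_hom) hom_comm_pow_right: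
  assumes x: "x \<in> carrier G" and y: "y \<in> carrier G" and c: "h (comm G (comm G x y) y) = \<one>\<^bsub>H\<^esub>"
  shows "h (comm G x (y [^] (t::nat))) = h (comm G x y [^] t)"
proof -
  have "h (comm G x y) \<otimes>\<^bsub>H\<^esub> h y = h y \<otimes>\<^bsub>H\<^esub> h (comm G x y)"
    using c x y hom_commutes_iff[of "comm G x y" y] by simp
  then show ?thesis
    using x y H.comm_pow_right[of "h x" "h y" t] by (simp add: hom_nat_pow)
qed

lemma (in group_hom) hom_mult_pow:
  assumes x: "x \<in> carrier G" and y: "y \<in> carrier G" and c: "h (comm G x y) = \<one>\<^bsub>H\<^esub>"
  shows "h ((x \<otimes> y) [^] (t::nat)) = h (x [^] t) \<otimes>\<^bsub>H\<^esub> h (y [^] t)"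
  using x y c H.pow_mult_distrib[of "h x" "h y" t] by (simp only: hom_commutes_iff) (simp add: hom_nat_pow)

lemma (in normal) quotient_hom: "group_hom G (G Mod H) (\<lambda>a. H #> a)"
  by (intro group_hom.intro group_hom_axioms.intro is_group factorgroup_is_group r_coset_hom_Mod)

lemma (in normal) quotient_eq_one: "a \<in> carrier G \<Longrightarrow> H #> a = \<one>\<^bsub>G Mod H\<^esub> \<longleftrightarrow> a \<in> H"
  by (metis one_FactGroup coset_join1 coset_join2 is_subgroup)

text \<open>The previous identities for the projection onto \<open>G Mod H\<close>, restated as
  membership in \<open>H\<close> so that later arguments stay inside \<open>G\<close>.\<close>

lemma (in normal) comm_pow_left_mem_iff:
  assumes h: "h \<in> carrier G" and k: "k \<in> carrier G" and c: "comm G (comm G h k) h \<in> H"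
  shows "comm G (h [^] (t::nat)) k \<in> H \<longleftrightarrow> comm G h k [^] t \<in> H"
proof -
  have "comm G (comm G h k) h \<in> carrier G" "comm G (h [^] t) k \<in> carrier G" "comm G h k [^] t \<in> carrier G"
    using h k by simp_all
  note q = this[THEN quotient_eq_one]
  have "H #> comm G (h [^] t) k = H #> (comm G h k [^] t)"
    using c by (intro group_hom.hom_comm_pow_left[OF quotient_hom h k]) (simp only: q)
  then show ?thesis using q(2,3) by argo
qed

lemma (in normal) comm_pow_right_mem_iff:
  assumes h: "h \<in> carrier G" and k: "k \<in> carrier G" and c: "comm G (comm G h k) k \<in> H"
  shows "comm G h (k [^] (t::nat)) \<in> H \<longleftrightarrow> comm G h k [^] t \<in> H"
proof -
  have "comm G (comm G h k) k \<in> carrier G" "comm G h (k [^] t) \<in> carrier G" "comm G h k [^] t \<in> carrier G"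
    using h k by simp_all
  note q = this[THEN quotient_eq_one]
  have "H #> comm G h (k [^] t) = H #> (comm G h k [^] t)"
    using c by (intro group_hom.hom_comm_pow_right[OF quotient_hom h k]) (simp only: q)
  then show ?thesis using q(2,3) by argo
qed

text \<open>Modulo \<open>H\<close> the group generated by \<open>S\<close> is abelian, so the
  \<open>t\<close>-th power map is a homomorphism there, and it kills the generators.\<close>

lemma (in normal) generate_pow_mem:
  assumes S: "S \<subseteq> carrier G" and t: "\<And>s. s \<in> S \<Longrightarrow> s [^] (t::nat) \<in> H"
    and ab: "\<And>a b. a \<in> generate G S \<Longrightarrow> b \<in> generate G S \<Longrightarrow> comm G a b \<in> H"
    and y: "y \<in> generate G S"
  shows "y [^] t \<in> H"
  using y
proof induction
  case (inv s)
  have "s \<in> carrier G" using inv S by blast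
  then show ?case using t[OF inv] by (simp add: nat_pow_inv)
next
  case (eng a b)
  interpret q: group "G Mod H" by (rule factorgroup_is_group)
  have c: "a \<in> carrier G" "b \<in> carrier G" using eng S generate_in_carrier by auto
  have "H #> comm G a b = \<one>\<^bsub>G Mod H\<^esub>"
    using ab[OF eng(1,2)] c by (subst quotient_eq_one) simp_all
  then have "H #> ((a \<otimes> b) [^] t) = (H #> (a [^] t)) \<otimes>\<^bsub>G Mod H\<^esub> (H #> (b [^] t))"
    by (rule group_hom.hom_mult_pow[OF quotient_hom c])
  also have "\<dots> = \<one>\<^bsub>G Mod H\<^esub> \<otimes>\<^bsub>G Mod H\<^esub> \<one>\<^bsub>G Mod H\<^esub>"
    using eng.IH c quotient_eq_one[THEN iffD2, of "a [^] t"] quotient_eq_one[THEN iffD2, of "b [^] t"]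
    by (simp only: nat_pow_closed)
  also have "\<dots> = \<one>\<^bsub>G Mod H\<^esub>" by (rule q.l_one[OF q.one_closed])
  finally show ?case using c by (subst (asm) quotient_eq_one) auto
qed (use t in auto)

text \<open>The cosets of \<open>B\<close> by \<open>y [^] i\<close> for
  \<open>i = 0, ..., k\<close> are disjoint: if two agreed, \<open>B\<close> would contain
  \<open>y [^] r\<close> with \<open>1 \<le> r \<le> k\<close>, and since \<open>r\<close> divides
  \<open>t\<close> also \<open>y [^] t\<close>.\<close>

lemma (in group) card_pow_cosets_le:
  assumes A: "subgroup A G" and B: "subgroup B G" "B \<subseteq> A" and fin: "finite A"
    and y: "y \<in> A" "y [^] (t::nat) \<notin> B"
    and t: "\<And>r. 1 \<le> r \<Longrightarrow> r \<le> k \<Longrightarrow> r dvd t"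
  shows "(k + 1) * card B \<le> card A"
proof -
  have AC: "A \<subseteq> carrier G" and BC: "B \<subseteq> carrier G" using A B subgroup.subset by auto
  have yc: "y \<in> carrier G" using y AC by auto
  have pow: "y [^] i \<in> A" for i :: nat
    using A y(1) by (induction i) (auto simp: subgroup.one_closed subgroup.m_closed)
  have lt: False if "i < j" "j \<le> k" "b \<in> B" "b' \<in> B" "y [^] i \<otimes> b = y [^] j \<otimes> b'" for i j b b'
  proof -
    have "y [^] j = y [^] i \<otimes> y [^] (j - i)" using that(1) yc by (simp add: nat_pow_mult)
    with that yc BC have "b = y [^] (j - i) \<otimes> b'" by (simp add: m_assoc subset_iff)
    then have "y [^] (j - i) = b \<otimes> inv b'" using that yc BC by (simp add: inv_solve_right subset_iff)
    then have d: "y [^] (j - i) \<in> B" using that B by (simp add: subgroup.m_closed subgroup.m_inv_closed)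
    have "j - i dvd t" using that by (intro t) auto
    then obtain q where "t = (j - i) * q" by (elim dvdE)
    then have "y [^] t = (y [^] (j - i)) [^] q" using yc by (simp add: nat_pow_pow)
    moreover have "(y [^] (j - i)) [^] q \<in> B"
      using d B(1) by (induction q) (auto simp: subgroup.one_closed subgroup.m_closed)
    ultimately show False using y(2) by simp
  qed
  have "inj_on (\<lambda>(i, b). y [^] i \<otimes> b) ({0..k} \<times> B)"
  proof (rule inj_onI, clarify)
    fix i b j b' assume *: "i \<in> {0..k}" "j \<in> {0..k}" "b \<in> B" "b' \<in> B" "y [^] i \<otimes> b = y [^] j \<otimes> b'"
    then have "i = j" using lt[of i j b b'] lt[of j i b' b] by (cases i j rule: linorder_cases) auto
    with * show "i = j \<and> b = b'" using yc BC by (auto simp: subset_iff)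
  qed
  moreover have "(\<lambda>(i, b). y [^] i \<otimes> b) ` ({0..k} \<times> B) \<subseteq> A"
    using pow A B by (auto simp: subset_iff subgroup.m_closed)
  ultimately have "card ({0..k} \<times> B) \<le> card A" using fin by (metis card_inj_on_le)
  then show ?thesis by (simp add: card_cartesian_product)
qed

subsection \<open>The lower central series\<close>

lemma lower_central_1 [simp]: "lower_central G N (Suc 0) = N"
  by (simp add: lower_central_def)

lemma lower_central_Suc:
  "m \<ge> 1 \<Longrightarrow> lower_central G N (Suc m) =
    generate G {comm G h k | h k. h \<in> lower_central G N m \<and> k \<in> N}"
  by (cases m) (simp_all add: lower_central_def commutator_subgroup_def)

lemma (in normal) comm_mem: "h \<in> H \<Longrightarrow> k \<in> carrier G \<Longrightarrow> comm G h k \<in> H"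
  using inv_op_closed2[of k "inv h"] m_closed[of h "k \<otimes> inv h \<otimes> inv k"]
  by (simp add: m_assoc mem_carrier)

lemma (in group) conj_comm:
  "g \<in> carrier G \<Longrightarrow> h \<in> carrier G \<Longrightarrow> k \<in> carrier G \<Longrightarrow>
    g \<otimes> comm G h k \<otimes> inv g = comm G (g \<otimes> h \<otimes> inv g) (g \<otimes> k \<otimes> inv g)"
  by (simp add: m_assoc inv_mult_group mult_inv_cancel)

context normal begin

lemma lower_central_normal: "m \<ge> 1 \<Longrightarrow> lower_central G H m \<lhd> G"
proof (induction m rule: nat_induct_at_least)
  case base
  then show ?case by (simp add: normal_axioms)
next
  case (Suc m)
  then interpret A: normal "lower_central G H m" G by simp
  show ?case unfolding lower_central_Suc[OF Suc(1)]
  proof (rule normal_generateI)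
    fix u g assume "u \<in> {comm G h k | h k. h \<in> lower_central G H m \<and> k \<in> H}" and g: "g \<in> carrier G"
    then obtain h k where u: "u = comm G h k" "h \<in> lower_central G H m" "k \<in> H" by blast
    have "g \<otimes> u \<otimes> inv g = comm G (g \<otimes> h \<otimes> inv g) (g \<otimes> k \<otimes> inv g)"
      unfolding u(1) using g u by (intro conj_comm) auto
    moreover have "g \<otimes> h \<otimes> inv g \<in> lower_central G H m" "g \<otimes> k \<otimes> inv g \<in> H"
      using g u A.inv_op_closed2 inv_op_closed2 by auto
    ultimately show "g \<otimes> u \<otimes> inv g \<in> {comm G h k | h k. h \<in> lower_central G H m \<and> k \<in> H}"
      by blast
  next
    show "{comm G h k | h k. h \<in> lower_central G H m \<and> k \<in> H} \<subseteq> carrier G"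
      using A.mem_carrier mem_carrier by blast
  qed
qed

lemma lower_central_subgroup: "m \<ge> 1 \<Longrightarrow> subgroup (lower_central G H m) G"
  using lower_central_normal normal_imp_subgroup by blast

lemma comm_mem_lower_central:
  "m \<ge> 1 \<Longrightarrow> h \<in> lower_central G H m \<Longrightarrow> k \<in> H \<Longrightarrow> comm G h k \<in> lower_central G H (Suc m)"
  unfolding lower_central_Suc by (rule generate.incl) blast

lemma lower_central_Suc_subset:
  assumes "m \<ge> 1"
  shows "lower_central G H (Suc m) \<subseteq> lower_central G H m"
  unfolding lower_central_Suc[OF assms]
proof (rule generate_subgroup_incl[OF _ lower_central_subgroup[OF assms]])
  show "{comm G h k | h k. h \<in> lower_central G H m \<and> k \<in> H} \<subseteq> lower_central G H m"
    using normal.comm_mem[OF lower_central_normal[OF assms]] mem_carrier by blast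
qed

lemma lower_central_antimono:
  assumes "1 \<le> i" "i \<le> j"
  shows "lower_central G H j \<subseteq> lower_central G H i"
  using assms(2,1) by (induction rule: dec_induct) (use lower_central_Suc_subset in \<open>auto dest: le_trans\<close>)

lemma lower_central_subset: "m \<ge> 1 \<Longrightarrow> lower_central G H m \<subseteq> H"
  using lower_central_antimono[of 1 m] by simp

text \<open>The factor of the terms \<open>Suc m\<close> and \<open>Suc (Suc m)\<close> is abelian
  and generated by commutators. A power that kills all of these kills the whole factor, so a
  surviving power survives on a single commutator.\<close>

lemma lower_central_pow_comm:
  assumes m: "m \<ge> 1" and y: "y \<in> lower_central G H (Suc m)"
    and t: "y [^] (t::nat) \<notin> lower_central G H (Suc (Suc m))"
  obtains h k where "h \<in> lower_central G H m" "k \<in> H"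
    "comm G h k [^] t \<notin> lower_central G H (Suc (Suc m))"
proof (rule ccontr)
  assume "\<not> thesis"
  with that have *: "\<And>h k. h \<in> lower_central G H m \<Longrightarrow> k \<in> H \<Longrightarrow>
    comm G h k [^] t \<in> lower_central G H (Suc (Suc m))" by blast
  let ?S = "{comm G h k | h k. h \<in> lower_central G H m \<and> k \<in> H}"
  have lc: "generate G ?S = lower_central G H (Suc m)" using m by (simp add: lower_central_Suc)
  have "y [^] t \<in> lower_central G H (Suc (Suc m))"
  proof (rule normal.generate_pow_mem[where S = ?S])
    show "lower_central G H (Suc (Suc m)) \<lhd> G" by (rule lower_central_normal) simp
    show "?S \<subseteq> carrier G"
      using mem_carrier lower_central_subset[OF m] by (blast intro: m_closed inv_closed)
    show "comm G a b \<in> lower_central G H (Suc (Suc m))"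
      if "a \<in> generate G ?S" "b \<in> generate G ?S" for a b
      using that lower_central_subset[of "Suc m"] unfolding lc by (intro comm_mem_lower_central) auto
    show "s [^] t \<in> lower_central G H (Suc (Suc m))" if "s \<in> ?S" for s
      using that * by blast
    show "y \<in> generate G ?S" using y lc by simp
  qed
  with t show False by simp
qed

text \<open>This supplies the commutation hypotheses of \<open>comm_pow_left_mem_iff\<close> and
  \<open>comm_pow_right_mem_iff\<close>.\<close>

lemma comm_comm_mem_lower_central:
  assumes "m \<ge> 1" "h \<in> lower_central G H m" "k \<in> H" "z \<in> H"
  shows "comm G (comm G h k) z \<in> lower_central G H (Suc (Suc m))"
  using assms by (intro comm_mem_lower_central) auto

text \<open>Two terms further down, \<open>comm G h k [^] t\<close> may be replaced by
  \<open>comm G (h [^] t) k\<close>. If \<open>h [^] t\<close> lay in the next term, this commutator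
  would already be trivial there.\<close>

lemma lower_central_pow_step:
  assumes m: "m \<ge> 1" and y: "y \<in> lower_central G H (Suc m)"
    and t: "y [^] (t::nat) \<notin> lower_central G H (Suc (Suc m))"
  obtains h where "h \<in> lower_central G H m" "h [^] t \<notin> lower_central G H (Suc m)"
proof -
  obtain h k where hk: "h \<in> lower_central G H m" "k \<in> H"
    "comm G h k [^] t \<notin> lower_central G H (Suc (Suc m))"
    using lower_central_pow_comm[OF assms] .
  have h: "h \<in> H" using hk(1) lower_central_subset[OF m] by auto
  have "comm G (h [^] t) k \<notin> lower_central G H (Suc (Suc m))"
    using hk h comm_comm_mem_lower_central[OF m hk(1,2) h]
    by (subst normal.comm_pow_left_mem_iff[OF lower_central_normal]) auto
  then have "h [^] t \<notin> lower_central G H (Suc m)"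
    using comm_mem_lower_central[of "Suc m" "h [^] t" k] hk by auto
  with hk that show ?thesis by blast
qed

lemma lower_central_pow_down:
  assumes "1 \<le> i" "i \<le> m"
    and "\<exists>h \<in> lower_central G H m. h [^] (t::nat) \<notin> lower_central G H (Suc m)"
  shows "\<exists>h \<in> lower_central G H i. h [^] t \<notin> lower_central G H (Suc i)"
  using assms(2,1,3)
proof (induction rule: inc_induct)
  case (step n)
  then show ?case by (metis lower_central_pow_step One_nat_def le_SucI)
qed

text \<open>Otherwise taking \<open>t\<close>-th powers would move every element of the
  \<open>m\<close>-th or a later term at least one term deeper, and \<open>c\<close> repetitions
  would carry \<open>y\<close> into the trivial term.\<close>

lemma nilpotent_pow:
  assumes m: "m \<ge> 1" and y: "y \<in> lower_central G H m"
    and c: "c \<ge> 1" "lower_central G H c = {\<one>}" and t: "y [^] ((t::nat) ^ c) \<noteq> \<one>"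
  shows "\<exists>h \<in> lower_central G H m. h [^] t \<notin> lower_central G H (Suc m)"
proof (rule ccontr)
  assume *: "\<not> ?thesis"
  have step: "h [^] t \<in> lower_central G H (Suc (m + i))" if "h \<in> lower_central G H (m + i)" for h i
    using * that lower_central_pow_down[of m "m + i" t] m by auto
  have yc: "y \<in> carrier G" using y lower_central_subset[OF m] mem_carrier by auto
  have "y [^] (t ^ i) \<in> lower_central G H (m + i)" for i
  proof (induction i)
    case (Suc i)
    then show ?case using step[of "y [^] (t ^ i)" i] yc by (simp add: nat_pow_pow mult.commute)
  qed (use y yc in simp)
  then have "y [^] (t ^ c) \<in> lower_central G H c"
    using lower_central_antimono[of c "m + c"] c by auto
  with c t show False by simp
qed

section \<open>Cardinality bounds for finite nilpotent normal subgroups\<close>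

lemma centralizer_mod_subgroup:
  assumes "M \<lhd> G" "b \<in> carrier G"
  shows "subgroup {w \<in> H. comm G w b \<in> M} G"
proof -
  interpret M: normal M G by fact
  show ?thesis
  proof
    fix x y assume "x \<in> {w \<in> H. comm G w b \<in> M}" "y \<in> {w \<in> H. comm G w b \<in> M}"
    then have xy: "x \<in> H" "y \<in> H" "comm G x b \<in> M" "comm G y b \<in> M" by auto
    have "comm G (x \<otimes> y) b = (x \<otimes> comm G y b \<otimes> inv x) \<otimes> comm G x b"
      using assms(2) xy by (simp add: m_assoc inv_mult_group mult_inv_cancel)
    also have "\<dots> \<in> M"
      using M.m_closed[OF M.inv_op_closed2[OF mem_carrier[OF xy(1)] xy(4)] xy(3)] .
    finally show "x \<otimes> y \<in> {w \<in> H. comm G w b \<in> M}" using xy by simp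
  next
    fix x assume "x \<in> {w \<in> H. comm G w b \<in> M}"
    then have x: "x \<in> H" "comm G x b \<in> M" by auto
    have "comm G (inv x) b = inv x \<otimes> inv (comm G x b) \<otimes> x"
      using assms(2) x by (simp add: m_assoc inv_mult_group mult_inv_cancel)
    also have "\<dots> \<in> M"
      using M.inv_op_closed1[OF mem_carrier[OF x(1)] M.m_inv_closed[OF x(2)]] .
    finally show "inv x \<in> {w \<in> H. comm G w b \<in> M}" using x by simp
  qed (use assms in auto)
qed

text \<open>The extra factor at the top comes from noncyclicity of the abelianization: the centralizer of
  \<open>b\<close> modulo the third term has large index, as seen by \<open>a\<close>, and large index over the second
  term, as seen by \<open>b\<close>.\<close>

lemma card_top_factor:
  assumes fin: "finite H" and t: "\<And>r. 1 \<le> r \<Longrightarrow> r \<le> k \<Longrightarrow> r dvd t"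
    and y: "y \<in> lower_central G H 2" "y [^] (t::nat) \<notin> lower_central G H 3"
  shows "(k + 1) ^ 2 * card (lower_central G H 2) \<le> card H"
proof -
  obtain a b where ab: "a \<in> H" "b \<in> H" "comm G a b [^] t \<notin> lower_central G H 3"
    using lower_central_pow_comm[of 1 y t] y by (auto simp: numeral_eq_Suc)
  have n3: "lower_central G H 3 \<lhd> G" by (rule lower_central_normal) simp
  define M where "M = {w \<in> H. comm G w b \<in> lower_central G H 3}"
  have M: "subgroup M G" unfolding M_def using ab by (intro centralizer_mod_subgroup n3) auto
  have cc: "comm G (comm G a b) z \<in> lower_central G H 3" if "z \<in> H" for z
    using comm_comm_mem_lower_central[of 1 a b z] ab that by (simp add: numeral_eq_Suc)
  \<comment> \<open>Modulo the third term this commutator is \<open>comm G a b [^] t\<close>, so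
    \<open>a [^] t\<close> lies outside \<open>M\<close>.\<close>
  have "comm G (a [^] t) b \<notin> lower_central G H 3"
    using ab cc by (subst normal.comm_pow_left_mem_iff[OF n3]) auto
  then have "(k + 1) * card M \<le> card H"
    using fin t ab by (intro card_pow_cosets_le[OF is_subgroup M _ _ ab(1)]) (auto simp: M_def)
  moreover have "(k + 1) * card (lower_central G H 2) \<le> card M"
  proof (rule card_pow_cosets_le[OF M])
    show "lower_central G H 2 \<subseteq> M"
      using lower_central_subset[of 2] comm_mem_lower_central[of 2 _ b] ab
      by (auto simp: M_def numeral_eq_Suc)
    show "b \<in> M"
      using ab normal_imp_subgroup[OF n3] commutes_iff_comm[of b b]
      by (simp add: M_def subgroup.one_closed)
    have "comm G a (b [^] t) \<notin> lower_central G H 3"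
      using ab cc by (subst normal.comm_pow_right_mem_iff[OF n3]) auto
    \<comment> \<open>The series is defined with the deeper element on the left, so the commutator
      is treated as the inverse of \<open>comm G (b [^] t) a\<close>.\<close>
    moreover have "comm G a (b [^] t) \<in> lower_central G H 3" if "b [^] t \<in> lower_central G H 2"
    proof -
      have "inv (comm G (b [^] t) a) \<in> lower_central G H 3"
        using comm_mem_lower_central[of 2 "b [^] t" a] that ab normal_imp_subgroup[OF n3]
        by (simp add: subgroup.m_inv_closed)
      then show ?thesis using ab by (simp add: inv_mult_group m_assoc)
    qed
    ultimately show "b [^] t \<notin> lower_central G H 2" by blast
  qed (use fin t lower_central_subgroup[of 2] in \<open>auto simp: M_def\<close>)
  ultimately show ?thesis
    by (metis (no_types, lifting) mult.assoc mult_le_mono2 order_trans power2_eq_square)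
qed

lemma card_nilpotent_ge:
  assumes fin: "finite H" and t: "\<And>r. 1 \<le> r \<Longrightarrow> r \<le> k \<Longrightarrow> r dvd t"
    and m: "m > 1" and y: "y \<in> lower_central G H m"
    and c: "c \<ge> 1" "lower_central G H c = {\<one>}" and yt: "y [^] ((t::nat) ^ c) \<noteq> \<one>"
  shows "(k + 1) ^ (m + 1) \<le> card H"
proof -
  have ex: "\<exists>h \<in> lower_central G H i. h [^] t \<notin> lower_central G H (Suc i)" if "1 \<le> i" "i \<le> m" for i
    using lower_central_pow_down[OF that nilpotent_pow[OF _ y c yt]] m by simp
  have fin': "finite (lower_central G H i)" if "i \<ge> 1" for i
    using fin lower_central_subset[OF that] finite_subset by blast
  \<comment> \<open>Here \<open>d\<close> counts the factors from the \<open>i\<close>-th to the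
    \<open>m\<close>-th; each contributes one factor \<open>k + 1\<close>. For \<open>d = 0\<close>
    the claim is only that the term is nonempty.\<close>
  have "(k + 1) ^ d \<le> card (lower_central G H i)" if "i \<ge> 1" "i + d = m + 1" for i d
    using that
  proof (induction d arbitrary: i)
    case 0
    then show ?case
      using fin'[of i] lower_central_subgroup[of i] subgroup.one_closed
      by (fastforce simp: Suc_le_eq card_gt_0_iff)
  next
    case (Suc d)
    obtain h where h: "h \<in> lower_central G H i" "h [^] t \<notin> lower_central G H (Suc i)"
      using ex[of i] Suc.prems by auto
    have "(k + 1) ^ Suc d \<le> (k + 1) * card (lower_central G H (Suc i))"
      unfolding power_Suc using Suc.IH[of "Suc i"] Suc.prems by (intro mult_le_mono2) simp
    also have "\<dots> \<le> card (lower_central G H i)"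
      using Suc.prems(1) fin' t lower_central_Suc_subset
      by (intro card_pow_cosets_le[OF _ _ _ _ h] lower_central_subgroup) auto
    finally show ?case .
  qed
  \<comment> \<open>The factors from the second to the \<open>m\<close>-th give the exponent
    \<open>m - 1\<close>, and the first one adds 2. Since \<open>m > 1\<close>, \<open>ex\<close> at
    index 2 provides the element that \<open>card_top_factor\<close> needs.\<close>
  from this[of 2 "m - 1"] m
  have "(k + 1) ^ 2 * (k + 1) ^ (m - 1) \<le> (k + 1) ^ 2 * card (lower_central G H 2)"
    by (intro mult_le_mono2) simp
  also have "\<dots> \<le> card H"
    using ex[of 2] m card_top_factor[OF fin t] by (auto simp: numeral_eq_Suc)
  finally show ?thesis using m by (simp flip: power_add)
qed

end

text \<open>Carries both the vanishing of a term and the membership of a power of \<open>x\<close>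
  over to a finite quotient.\<close>

lemma (in group_hom) lower_central_img:
  assumes N: "N \<lhd> G" and m: "m \<ge> 1"
  shows "lower_central H (h ` N) m = h ` lower_central G N m"
  using m
proof (induction m rule: nat_induct_at_least)
  case (Suc m)
  interpret N: normal N G by fact
  have sub: "lower_central G N m \<subseteq> carrier G" "N \<subseteq> carrier G"
    using N.lower_central_subset[OF Suc(1)] N.subset by auto
  have "{comm H u v |u v. u \<in> h ` lower_central G N m \<and> v \<in> h ` N} =
      h ` {comm G u v |u v. u \<in> lower_central G N m \<and> v \<in> N}" (is "?L = ?R")
  proof
    show "?L \<subseteq> ?R"
    proof
      fix z assume "z \<in> ?L"
      then obtain u v where "z = comm H (h u) (h v)" "u \<in> lower_central G N m" "v \<in> N" by auto
      then show "z \<in> ?R" using sub by (intro image_eqI[of _ _ "comm G u v"]) auto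
    qed
    show "?R \<subseteq> ?L"
    proof
      fix z assume "z \<in> ?R"
      then obtain u v where *: "z = h (comm G u v)" "u \<in> lower_central G N m" "v \<in> N" by auto
      then have "z = comm H (h u) (h v)" using sub by auto
      with * show "z \<in> ?L" by blast
    qed
  qed
  then show ?case
    using sub Suc by (auto simp: lower_central_Suc intro!: generate_img)
qed simp

subsection \<open>Word length and separation depth\<close>

text \<open>The predicate under \<open>LEAST\<close> in \<open>word_length\<close>, named so that
  the rules for \<open>LEAST\<close> apply to it directly.\<close>

definition word_rep :: "('a, 'b) monoid_scheme \<Rightarrow> 'a set \<Rightarrow> nat \<Rightarrow> 'a \<Rightarrow> bool" where
  "word_rep G S n y \<longleftrightarrow> (\<exists>ws. length ws = n \<and> set ws \<subseteq> S \<union> m_inv G ` S \<and>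
     foldr (\<otimes>\<^bsub>G\<^esub>) ws \<one>\<^bsub>G\<^esub> = y)"

lemma word_length_eq: "word_length G S y = (LEAST n. word_rep G S n y)"
  by (simp add: word_length_def word_rep_def)

lemma word_length_le: "word_rep G S n y \<Longrightarrow> word_length G S y \<le> n"
  unfolding word_length_eq by (rule Least_le)

context group begin

lemma foldr_mult_closed: "set ws \<subseteq> carrier G \<Longrightarrow> foldr (\<otimes>) ws \<one> \<in> carrier G"
  by (induction ws) auto

lemma foldr_mult_eq:
  assumes "set ws \<subseteq> carrier G" "z \<in> carrier G"
  shows "foldr (\<otimes>) ws z = foldr (\<otimes>) ws \<one> \<otimes> z"
  using assms(1)
proof (induction ws)
  case (Cons w ws)
  then show ?case using assms(2) foldr_mult_closed[of ws] by (simp add: m_assoc)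
qed (use assms(2) in simp)

lemma word_rep_mult:
  assumes S: "S \<subseteq> carrier G" and "word_rep G S a y" "word_rep G S b z"
  shows "word_rep G S (a + b) (y \<otimes> z)"
proof -
  let ?L = "S \<union> m_inv G ` S"
  obtain us where us: "length us = a" "set us \<subseteq> ?L" "foldr (\<otimes>) us \<one> = y"
    using assms(2) unfolding word_rep_def by blast
  obtain vs where vs: "length vs = b" "set vs \<subseteq> ?L" "foldr (\<otimes>) vs \<one> = z"
    using assms(3) unfolding word_rep_def by blast
  have L: "?L \<subseteq> carrier G" using S by blast
  have "z \<in> carrier G" using foldr_mult_closed[of vs] vs L by blast
  then have "foldr (\<otimes>) (us @ vs) \<one> = y \<otimes> z"
    using foldr_mult_eq[of us z] us(3) vs(3) subset_trans[OF us(2) L] by simp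
  with us vs show ?thesis
    unfolding word_rep_def by (intro exI[of _ "us @ vs"]) simp
qed

lemma word_rep_one: "word_rep G S 0 \<one>"
  by (simp add: word_rep_def)

lemma word_rep_letter: "S \<subseteq> carrier G \<Longrightarrow> s \<in> S \<union> m_inv G ` S \<Longrightarrow> word_rep G S 1 s"
  unfolding word_rep_def by (intro exI[of _ "[s]"]) (auto intro!: r_one)

lemma generate_word_rep:
  assumes S: "S \<subseteq> carrier G" and "y \<in> generate G S"
  shows "\<exists>n. word_rep G S n y"
  using assms(2)
proof induction
  case (eng a b)
  then show ?case using word_rep_mult[OF S] by blast
next
  case one
  show ?case using word_rep_one by blast
next
  case (incl h)
  then show ?case using word_rep_letter[OF S, of h] by blast
next
  case (inv h)
  then show ?case using word_rep_letter[OF S, of "inv h"] by blast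
qed

lemma word_rep_word_length:
  assumes "finite_generating_set G S" "y \<in> carrier G"
  shows "word_rep G S (word_length G S y) y"
proof -
  have "\<exists>n. word_rep G S n y"
    using generate_word_rep[of S y] assms by (simp add: finite_generating_set_def)
  then show ?thesis unfolding word_length_eq by (rule LeastI_ex)
qed

lemma word_length_mult_le:
  assumes "finite_generating_set G S" "y \<in> carrier G" "z \<in> carrier G"
  shows "word_length G S (y \<otimes> z) \<le> word_length G S y + word_length G S z"
  using assms by (intro word_length_le word_rep_mult word_rep_word_length)
    (auto simp: finite_generating_set_def)

text \<open>Distortion is measured with \<open>S\<close> and \<open>RF\<close> with
  \<open>T\<close>; this is the bridge. \<open>K\<close> bounds the \<open>T\<close>-length of the
  letters from \<open>S\<close> and their inverses.\<close>

lemma word_length_change_generators: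
  assumes S: "finite_generating_set G S" and T: "finite_generating_set G T"
  obtains K where "\<And>y. y \<in> carrier G \<Longrightarrow> word_length G T y \<le> K * word_length G S y"
proof
  let ?L = "S \<union> m_inv G ` S"
  \<comment> \<open>Inserting 0 keeps \<open>Max\<close> meaningful when \<open>S\<close> is
    empty.\<close>
  define K where "K = Max (insert 0 (word_length G T ` ?L))"
  have L: "?L \<subseteq> carrier G" and fin: "finite ?L" using S by (auto simp: finite_generating_set_def)
  have K: "word_length G T s \<le> K" if "s \<in> ?L" for s
    unfolding K_def using fin that by (intro Max_ge) auto
  have *: "word_length G T (foldr (\<otimes>) ws \<one>) \<le> K * length ws" if "set ws \<subseteq> ?L" for ws
    using that
  proof (induction ws)
    case Nil
    then show ?case using word_length_le[OF word_rep_one, of T] by simp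
  next
    case (Cons s ws)
    have "s \<in> carrier G" "foldr (\<otimes>) ws \<one> \<in> carrier G"
      using Cons.prems L by (auto intro!: foldr_mult_closed)
    then have "word_length G T (foldr (\<otimes>) (s # ws) \<one>)
        \<le> word_length G T s + word_length G T (foldr (\<otimes>) ws \<one>)"
      using word_length_mult_le[OF T] by simp
    also have "\<dots> \<le> K + K * length ws" using Cons K[of s] by (intro add_mono) auto
    finally show ?case by simp
  qed
  show "word_length G T y \<le> K * word_length G S y" if "y \<in> carrier G" for y
    using word_rep_word_length[OF S that] * unfolding word_rep_def by metis
qed

text \<open>Ensures that the \<open>Max\<close> in \<open>RF\<close> ranges over a finite
  set.\<close>

lemma finite_word_ball:
  assumes S: "finite_generating_set G S"
  shows "finite {y \<in> carrier G. word_length G S y \<le> n}"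
proof (rule finite_subset)
  let ?W = "{ws. set ws \<subseteq> S \<union> m_inv G ` S \<and> length ws \<le> n}"
  show "{y \<in> carrier G. word_length G S y \<le> n} \<subseteq> (\<lambda>ws. foldr (\<otimes>) ws \<one>) ` ?W"
  proof clarify
    fix y assume "y \<in> carrier G" and n: "word_length G S y \<le> n"
    then obtain ws where "length ws = word_length G S y" "set ws \<subseteq> S \<union> m_inv G ` S" 
      "foldr (\<otimes>) ws \<one> = y"
      using word_rep_word_length[OF S] unfolding word_rep_def by blast
    with n show "y \<in> (\<lambda>ws. foldr (\<otimes>) ws \<one>) ` ?W" by (intro image_eqI[of _ _ ws]) auto
  qed
  show "finite ((\<lambda>ws. foldr (\<otimes>) ws \<one>) ` ?W)"
    using S by (intro finite_imageI finite_lists_length_le) (auto simp: finite_generating_set_def)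
qed

text \<open>\<open>residually_finite\<close> provides an arbitrary homomorphism,
  \<open>separation_depth\<close> asks for a surjective one; shrinking the target to the image
  reconciles them.\<close>

lemma separation_depth_attained:
  assumes rf: "residually_finite G" and y: "y \<in> carrier G" "y \<noteq> \<one>"
  obtains H :: "nat monoid" and \<phi> where "group H" "finite (carrier H)" "\<phi> \<in> epi G H"
    "\<phi> y \<noteq> \<one>\<^bsub>H\<^esub>" "separation_depth G y = order H"
proof -
  obtain H :: "nat monoid" and \<phi> where H: "group H" "finite (carrier H)" "\<phi> \<in> hom G H" "\<phi> y \<noteq> \<one>\<^bsub>H\<^esub>"
    using rf y unfolding residually_finite_def by blast
  interpret \<phi>: group_hom G H \<phi> using H by (intro group_hom.intro group_hom_axioms.intro is_group)
  let ?I = "H\<lparr>carrier := \<phi> ` carrier G\<rparr>"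
  have "group ?I" by (intro subgroup.subgroup_is_group \<phi>.img_is_subgroup H(1))
  moreover have "\<phi> \<in> epi G ?I" using H(3) by (auto simp: epi_def hom_def)
  moreover have "finite (carrier ?I)" using H(2) \<phi>.img_is_subgroup by (simp add: subgroup.subset finite_subset[OF subgroup.subset])
  ultimately have "\<exists>k (H :: nat monoid) \<phi>. group H \<and> finite (carrier H) \<and> \<phi> \<in> epi G H \<and>
      \<phi> y \<noteq> \<one>\<^bsub>H\<^esub> \<and> k = order H"
    using H(4) by (intro exI[of _ "order ?I"] exI[of _ ?I] exI[of _ \<phi>]) simp
  from LeastI_ex[OF this] show ?thesis
    using that unfolding separation_depth_def by blast
qed

lemma separation_depth_le_RF:
  assumes "finite_generating_set G T" "y \<in> carrier G" "y \<noteq> \<one>" "word_length G T y \<le> n"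
  shows "separation_depth G y \<le> RF G T n"
  unfolding RF_def
proof (rule Max_ge)
  have "{separation_depth G x | x. x \<in> carrier G \<and> x \<noteq> \<one> \<and> word_length G T x \<le> n}
      \<subseteq> separation_depth G ` {y \<in> carrier G. word_length G T y \<le> n}" by auto
  then show "finite {separation_depth G x | x. x \<in> carrier G \<and> x \<noteq> \<one> \<and> word_length G T x \<le> n}"
    using finite_word_ball[OF assms(1)] finite_surj by blast
qed (use assms in auto)

text \<open>At the length of \<open>x [^] n\<close> the function \<open>f\<close> is at most a
  constant times \<open>n\<close>, hence of order at most \<open>D ^ k\<close>, while
  \<open>f\<close> grows at least exponentially. So the length is linear in
  \<open>k\<close>.\<close>

lemma distorted_pow_length:
  fixes D :: nat
  assumes dist: "at_least_strictly_exp_distorted G S x"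
  obtains A where "\<And>k n. k \<ge> 1 \<Longrightarrow> 1 \<le> n \<Longrightarrow> n \<le> D ^ k \<Longrightarrow> word_length G S (x [^] (n::nat)) \<le> A * k"
proof -
  obtain f where mono: "mono_on {1..} f" and exp: "(\<lambda>n. 2 ^ n) \<preceq> f"
    and f: "strictly_distorted G S f x"
    using dist unfolding at_least_strictly_exp_distorted_def by blast
  obtain C where C: "C > 0" "\<And>n. n \<ge> 1 \<Longrightarrow> 2 ^ n \<le> C * f (C * n)"
    using exp unfolding growth_le_def by blast
  obtain C2 :: real where C2: "\<And>n::nat. n > 0 \<Longrightarrow> real (f (word_length G S (x [^] n))) \<le> C2 * real n"
    using f unfolding strictly_distorted_def by blast
  \<comment> \<open>\<open>B\<close> absorbs the constants into a power of two, so that in the end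
    only exponents are compared. The \<open>max\<close> makes the factor nonnegative.\<close>
  obtain B where "max C2 0 * C < 2 ^ B" using real_arch_pow[of 2 "max C2 0 * C"] by auto
  then have B: "max C2 0 * C \<le> 2 ^ B" by simp
  have ED: "D \<le> 2 ^ D" using less_exp[of D] by simp
  show ?thesis
  proof
    fix k n :: nat assume k: "k \<ge> 1" and n: "1 \<le> n" "n \<le> D ^ k"
    define w where "w = word_length G S (x [^] n)"
    \<comment> \<open>The lower bound on \<open>f\<close> is known at multiples of \<open>C\<close>,
      so the length \<open>w\<close> is rounded down to \<open>C * l\<close>. The case
      \<open>l = 0\<close> is separate because nothing is known about \<open>f\<close> at 0.\<close>
    define l where "l = w div C"
    have l: "l \<le> B + D * k"
    proof (cases "l = 0")
      case False
      have "C * l \<le> w" by (simp add: l_def)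
      moreover have "1 \<le> C * l" using False C(1) by (simp add: Suc_le_eq)
      ultimately have "f (C * l) \<le> f w" by (intro mono_onD[OF mono]) (simp_all only: atLeast_iff order_trans[of 1 "C * l" w])
      then have "real (2 ^ l) \<le> real C * real (f w)"
        using C(2)[of l] False by (metis mult_le_mono2 of_nat_le_iff of_nat_mult order_trans Suc_leI neq0_conv One_nat_def)
      also have "\<dots> \<le> real C * (max C2 0 * real (D ^ k))"
      proof (intro mult_left_mono)
        have "real (f w) \<le> C2 * real n" using C2[of n] n by (simp add: w_def)
        also have "\<dots> \<le> max C2 0 * real (D ^ k)" using n(2) by (intro mult_mono) (simp_all del: of_nat_power)
        finally show "real (f w) \<le> max C2 0 * real (D ^ k)" .
      qed simp
      also have "\<dots> \<le> 2 ^ B * real ((2 ^ D) ^ k)"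
        using mult_mono[OF B, of "real (D ^ k)" "real ((2 ^ D) ^ k)"] power_mono[OF ED, of k]
        by (simp add: mult_ac del: of_nat_power)
      also have "\<dots> = real (2 ^ (B + D * k))" by (simp add: power_add power_mult)
      finally have "(2::nat) ^ l \<le> 2 ^ (B + D * k)" by (simp only: of_nat_le_iff)
      then show ?thesis by simp
    qed simp
    have "w \<le> C * (l + 1)"
      using C(1) by (simp add: l_def dividend_less_times_div less_imp_le add.commute)
    also have "\<dots> \<le> C * ((B + D + 1) * k)"
    proof (intro mult_le_mono2)
      have "l + 1 \<le> B * 1 + D * k + 1 * 1" using l by simp
      also have "\<dots> \<le> B * k + D * k + 1 * k" using k by (intro add_mono mult_mono) auto
      finally show "l + 1 \<le> (B + D + 1) * k" by (simp add: algebra_simps)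
    qed
    finally show "word_length G S (x [^] n) \<le> (C * (B + D + 1)) * k" unfolding w_def mult.assoc .
  qed
qed

text \<open>Reduces a lower bound on \<open>RF\<close> to one on the order of any finite quotient in
  which one specific power of \<open>x\<close> survives. That power has length linear in
  \<open>k\<close>.\<close>

lemma growth_le_RF:
  assumes S: "finite_generating_set G S" and T: "finite_generating_set G T"
    and rf: "residually_finite G" and x: "x \<in> carrier G" "ord x = 0"
    and dist: "at_least_strictly_exp_distorted G S x" and j: "j \<ge> 1"
    and lower: "\<And>k (H :: nat monoid) \<phi>. k \<ge> 1 \<Longrightarrow> group H \<Longrightarrow> finite (carrier H) \<Longrightarrow> \<phi> \<in> epi G H \<Longrightarrow>
      \<phi> (x [^] (j * Lcm {1..k} ^ c)) \<noteq> \<one>\<^bsub>H\<^esub> \<Longrightarrow> g k \<le> order H"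
  shows "g \<preceq> RF G T"
proof -
  obtain A where A: "\<And>k n. k \<ge> 1 \<Longrightarrow> 1 \<le> n \<Longrightarrow> n \<le> (j * 16 ^ c) ^ k \<Longrightarrow>
      word_length G S (x [^] n) \<le> A * k"
    using distorted_pow_length[OF dist, of "j * 16 ^ c"] by auto
  obtain K where K: "\<And>y. y \<in> carrier G \<Longrightarrow> word_length G T y \<le> K * word_length G S y"
    using word_length_change_generators[OF S T] by blast
  have "g k \<le> Suc (K * A) * RF G T (Suc (K * A) * k)" if k: "k \<ge> 1" for k
  proof -
    let ?n = "j * Lcm {1..k} ^ c"
    have pos: "?n \<ge> 1" using j Lcm_upto_pos[of k] by (simp add: Suc_le_eq)
    \<comment> \<open>Bounding \<open>j\<close> by \<open>j ^ k\<close> puts the whole exponent in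
      the form \<open>D ^ k\<close> with \<open>D = j * 16 ^ c\<close>.\<close>
    have "?n \<le> j ^ k * (16 ^ k) ^ c"
      using k j by (intro mult_mono power_mono Lcm_upto_le) (auto simp: self_le_power)
    also have "\<dots> = (j * 16 ^ c) ^ k" by (simp add: power_mult_distrib mult.commute flip: power_mult)
    finally have "word_length G S (x [^] ?n) \<le> A * k" by (intro A k pos)
    then have "word_length G T (x [^] ?n) \<le> K * (A * k)"
      using K[of "x [^] ?n"] x by (meson le_trans mult_le_mono2 nat_pow_closed)
    also have "\<dots> \<le> Suc (K * A) * k" by simp
    finally have len: "word_length G T (x [^] ?n) \<le> Suc (K * A) * k" .
    \<comment> \<open>\<open>ord x = 0\<close> encodes infinite order.\<close>
    have ne: "x [^] ?n \<noteq> \<one>" using x pos by (simp add: pow_eq_id)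
    obtain H :: "nat monoid" and \<phi> where H: "group H" "finite (carrier H)" "\<phi> \<in> epi G H"
      "\<phi> (x [^] ?n) \<noteq> \<one>\<^bsub>H\<^esub>" "separation_depth G (x [^] ?n) = order H"
      using separation_depth_attained[OF rf _ ne] x by auto
    have "g k \<le> separation_depth G (x [^] ?n)" using lower[OF k H(1-4)] H(5) by simp
    also have "\<dots> \<le> RF G T (Suc (K * A) * k)"
      using x ne len by (intro separation_depth_le_RF T) auto
    also have "\<dots> \<le> Suc (K * A) * RF G T (Suc (K * A) * k)" by simp
    finally show ?thesis .
  qed
  then show ?thesis unfolding growth_le_def by (intro exI[of _ "Suc (K * A)"]) simp
qed

end

section \<open>The linear and the polynomial lower bound\<close>

theorem corollary1p6:
  fixes G :: "('a, 'b) monoid_scheme" and S T :: "'a set" and x :: 'a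
  assumes "group G"
    and "finite_generating_set G S"
    and "finite_generating_set G T"
    and "residually_finite G"
    and "solvable G"
    and "infinite_prufer_rank G"
    and "x \<in> fitting G"
    and "x \<noteq> \<one>\<^bsub>G\<^esub>"
    and "group.ord G x = 0"
    and "at_least_strictly_exp_distorted G S x"
  shows "(\<lambda>n. n) \<preceq> RF G T \<and>
    (\<forall>m. has_nilpotent_depth G x m \<and> m > 1 \<longrightarrow> (\<lambda>n. n ^ (m + 1)) \<preceq> RF G T)"
proof (intro conjI allI impI)
  interpret group G by fact
  have "\<Union>{N. normal_nilpotent G N} \<subseteq> carrier G"
    using normal_imp_subgroup subgroup.subset unfolding normal_nilpotent_def by blast
  then have x: "x \<in> carrier G" using assms(7) generate_in_carrier unfolding fitting_def by blast
  note lower = growth_le_RF[OF assms(2-4) x assms(9,10)]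
  show "(\<lambda>n. n) \<preceq> RF G T"
  proof (rule lower[of 1 1])
    fix k :: nat and H :: "nat monoid" and \<phi>
    assume H: "group H" "finite (carrier H)" "\<phi> \<in> epi G H" "\<phi> (x [^]\<^bsub>G\<^esub> (1 * Lcm {1..k} ^ 1)) \<noteq> \<one>\<^bsub>H\<^esub>"
    interpret \<phi>: group_hom G H \<phi>
      using H by (intro group_hom.intro group_hom_axioms.intro is_group) (auto simp: epi_def)
    show "k \<le> order H"
    proof (rule ccontr)
      assume "\<not> k \<le> order H"
      \<comment> \<open>The order would be one of the numbers \<open>1, ..., k\<close>, and the
        image of \<open>x\<close> raised to the order of \<open>H\<close> is trivial, contradicting
        survival.\<close>
      then have "order H dvd Lcm {1..k}"
        using \<phi>.H.order_gt_0_iff_finite H(2) by (intro dvd_Lcm) (auto simp: Suc_le_eq)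
      then obtain q where "Lcm {1..k} = order H * q" by (elim dvdE)
      then have "\<phi> (x [^]\<^bsub>G\<^esub> Lcm {1..k}) = \<phi> x [^]\<^bsub>H\<^esub> (order H * q)"
        using \<phi>.hom_nat_pow[OF x] by simp
      also have "\<dots> = (\<phi> x [^]\<^bsub>H\<^esub> order H) [^]\<^bsub>H\<^esub> q"
        using \<phi>.H.nat_pow_pow[OF \<phi>.hom_closed[OF x]] by simp
      also have "\<dots> = \<one>\<^bsub>H\<^esub>"
        using \<phi>.H.pow_order_eq_1[OF \<phi>.hom_closed[OF x]] \<phi>.H.nat_pow_one by simp
      finally show False using H(4) by simp
    qed
  qed simp
  fix m assume *: "has_nilpotent_depth G x m \<and> m > 1"
  then have m: "m > 1" by simp
  obtain N where "normal_nilpotent G N" and ne: "generate G {x} \<inter> lower_central G N m \<noteq> {\<one>\<^bsub>G\<^esub>}"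
    using * unfolding has_nilpotent_depth_def by metis
  then obtain c where N: "N \<lhd> G" and c: "c \<ge> 1" "lower_central G N c = {\<one>\<^bsub>G\<^esub>}"
    unfolding normal_nilpotent_def by metis
  interpret N: normal N G by fact
  have sub: "subgroup (lower_central G N m) G" using m by (intro N.lower_central_subgroup) simp
  \<comment> \<open>This rules out an empty intersection, so differing from the trivial set means
    having a nontrivial element.\<close>
  have "\<one>\<^bsub>G\<^esub> \<in> generate G {x} \<inter> lower_central G N m"
    using generate.one subgroup.one_closed[OF sub] by blast
  with ne obtain y where "y \<in> generate G {x} \<inter> lower_central G N m" and ny: "y \<noteq> \<one>\<^bsub>G\<^esub>"
    by (metis is_singletonI' is_singleton_def singletonD empty_iff)
  then have y: "y \<in> generate G {x}" "y \<in> lower_central G N m" by simp_all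
  then obtain i :: int where i: "y = x [^]\<^bsub>G\<^esub> i" using generate_pow[OF x] by blast
  have "i \<noteq> 0" using i ny int_pow_0 by metis
  \<comment> \<open>\<open>growth_le_RF\<close> takes a natural exponent, so for negative
    \<open>i\<close> the element \<open>y\<close> is replaced by its inverse.\<close>
  then obtain j :: nat where j: "j \<ge> 1" "i = int j \<or> i = - int j"
    by (metis int_cases2 One_nat_def Suc_leI gr0I int_ops(1) minus_zero)
  have "x [^]\<^bsub>G\<^esub> j = y \<or> x [^]\<^bsub>G\<^esub> j = inv\<^bsub>G\<^esub> y"
    using j(2)
  proof
    assume "i = int j"
    then show ?thesis using i int_pow_int by metis
  next
    assume "i = - int j"
    then have "y = inv\<^bsub>G\<^esub> (x [^]\<^bsub>G\<^esub> j)"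
      using i int_pow_neg_int[OF x] by metis
    then show ?thesis using inv_inv[OF nat_pow_closed[OF x]] by metis
  qed
  then have xj: "x [^]\<^bsub>G\<^esub> j \<in> lower_central G N m"
    using y(2) subgroup.m_inv_closed[OF sub y(2)] by metis
  show "(\<lambda>n. n ^ (m + 1)) \<preceq> RF G T"
  \<comment> \<open>The exponent \<open>c\<close>, an index at which the series of \<open>N\<close>
    is trivial, matches the hypothesis of \<open>card_nilpotent_ge\<close> with
    \<open>t = Lcm {1..k}\<close>.\<close>
  proof (rule lower[OF j(1), of c])
    fix k :: nat and H :: "nat monoid" and \<phi>
    assume H: "group H" "finite (carrier H)" "\<phi> \<in> epi G H" "\<phi> (x [^]\<^bsub>G\<^esub> (j * Lcm {1..k} ^ c)) \<noteq> \<one>\<^bsub>H\<^esub>"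
    interpret \<phi>: group_hom G H \<phi>
      using H by (intro group_hom.intro group_hom_axioms.intro is_group) (auto simp: epi_def)
    have "\<phi> ` carrier G = carrier H" using H(3) by (simp add: epi_def)
    \<comment> \<open>Surjectivity of \<open>\<phi>\<close> makes the image of \<open>N\<close>
      normal in \<open>H\<close>.\<close>
    then interpret K: normal "\<phi> ` N" H
      by (intro N.surj_hom_normal_subgroup \<phi>.group_hom_axioms)
    have fin: "finite (\<phi> ` N)" using K.subset H(2) finite_subset by blast
    have "(k + 1) ^ (m + 1) \<le> card (\<phi> ` N)"
    proof (rule K.card_nilpotent_ge[OF fin _ m _ c(1)])
      show "\<phi> (x [^]\<^bsub>G\<^esub> j) \<in> lower_central H (\<phi> ` N) m"
        using xj m by (simp add: \<phi>.lower_central_img[OF N])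
      show "lower_central H (\<phi> ` N) c = {\<one>\<^bsub>H\<^esub>}"
        using c by (simp add: \<phi>.lower_central_img[OF N])
      show "\<phi> (x [^]\<^bsub>G\<^esub> j) [^]\<^bsub>H\<^esub> (Lcm {1..k} ^ c) \<noteq> \<one>\<^bsub>H\<^esub>"
        using H(4) \<phi>.hom_nat_pow[OF x] \<phi>.H.nat_pow_pow[OF \<phi>.hom_closed[OF x]] by simp
    qed (auto intro: dvd_Lcm)
    also have "\<dots> \<le> order H" unfolding order_def using K.subset H(2) by (intro card_mono)
    finally show "k ^ (m + 1) \<le> order H"
      using power_mono[of k "k + 1" "m + 1"] by simp
  qed
qed

end
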